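(* Let $p \equiv 1 \pmod{9}$ be a prime and let $q=p^\alpha$ with $\alpha \geq 1$. Then every value $K(a,b,q,9)$ with $0 \leq a,b \leq q-1$ lies in the threefold sum \[\mathbb{H}_3 + \mathbb{H}_3 + \mathbb{H}_3 = \{ w_1+ w_2 + w_3 : w_1,w_2,w_3 \in \mathbb{H}_3\}.\] Moreover, this set is filled out as $q\to\infty$ in the following sense: for every $\epsilon>0$, every $b\in\mathbb{Z}$ and every $w\in \mathbb{H}_3+\mathbb{H}_3+\mathbb{H}_3$, for every sufficiently large prime power $q=p^\alpha$ with $p\equiv 1\pmod 9$ there exists $a\in\mathbb{Z}/q\mathbb{Z}$ with $|K(a,b,q,9)-w|<\epsilon$.
   Context: Let $e(x)=\exp(2\pi i x)$. For an odd prime power $q$ and a positive divisor $d$ of $\phi(q)$, define $K(a,b,q,d)=\sum_{u\in(\mathbb{Z}/q\mathbb{Z})^\times,\ u^d=1} e\big(\frac{au+bu^{-1}}{q}\big)$, where $u^{-1}$ is the inverse of $u$ modulo $q$. $\mathbb{H}_3$ denotes the closure of the bounded region of $\mathbb{C}$ enclosed by the deltoid $\theta\mapsto 2e^{i\theta}+e^{-2i\theta}$, $\theta\in[0,2\pi]$. *)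

theory Defs
  imports "HOL-Analysis.Analysis" "HOL-Number_Theory.Number_Theory"
begin

definition add_char :: "real \<Rightarrow> complex" where
  "add_char x = exp (2 * complex_of_real pi * \<i> * complex_of_real x)"

text \<open>
  Units modulo \<open>q\<close> are represented by the integers in \<open>{0..<q}\<close> coprime to \<open>q\<close>; the summand
  depends only on the residue class of \<open>u\<close>, and of \<open>u\<close>'s inverse, modulo \<open>q\<close>.
\<close>
definition K :: "int \<Rightarrow> int \<Rightarrow> nat \<Rightarrow> nat \<Rightarrow> complex" where
  "K a b q d =
     (\<Sum>u | u \<in> {0..<int q} \<and> coprime u (int q) \<and> [u ^ d = 1] (mod int q).
        add_char (real_of_int (a * u + b * modular_inverse (int q) u) / real q))"

definition deltoid :: "real \<Rightarrow> complex" where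
  "deltoid \<theta> = 2 * exp (\<i> * complex_of_real \<theta>) + exp (- 2 * \<i> * complex_of_real \<theta>)"

text \<open>
  \<open>inside S\<close> is the union of the bounded connected components of the complement of \<open>S\<close>; the
  deltoid is a simple closed curve, so here it is the bounded region that the curve encloses.
\<close>
definition H3 :: "complex set" where
  "H3 = closure (inside (deltoid ` {0..2 * pi}))"

definition H3_threefold_sum :: "complex set" where
  "H3_threefold_sum = {w1 + w2 + w3 | w1 w2 w3. w1 \<in> H3 \<and> w2 \<in> H3 \<and> w3 \<in> H3}"

end

theory Submission
  imports Defs "HOL-Real_Asymp.Real_Asymp"
begin

text \<open>
  The ninth roots of unity modulo \<open>q = p\<^sup>\<alpha>\<close> are the powers of some \<open>g\<close> with \<open>\<Phi>\<^sub>9(g) = g\<^sup>6 + g\<^sup>3 + 1 \<equiv> 0\<close>.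
  Grouping the exponents modulo 3, the three terms of a group multiply to 1, so each group contributes
  a trace of \<open>SU(3)\<close>, and these traces fill the deltoid region: both are the set where the discriminant
  of \<open>z\<^sup>3 - w z\<^sup>2 + w' z - 1\<close> (with \<open>w'\<close> the conjugate of \<open>w\<close>) is nonpositive, and this discriminant
  increases along rays from the origin.

  For the density, irreducibility of \<open>\<Phi>\<^sub>9\<close> shows that no fixed nonzero integer combination of
  \<open>1, g, \<dots>, g\<^sup>5\<close> vanishes modulo \<open>q\<close> once \<open>q\<close> is large. Hence the mean over \<open>a\<close> of a fixed trigonometric
  polynomial at the points \<open>(a g\<^sup>k / q)\<^sub>k\<close>, \<open>k < 6\<close>, equals its constant term exactly, and a polynomial peaked
  at the target point forces some \<open>a\<close> to come close to it. The fixed \<open>b\<close> only translates the target.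
\<close>

hide_const (open) up_ring.coeff up_ring.monom module.smult

section \<open>The deltoid region\<close>

text \<open>The discriminant of \<open>z^3 - w z^2 + cnj w z - 1\<close>; it is real because
  conjugating and reversing the coefficients only changes the sign of the cubic.\<close>

definition deltoid_disc :: "complex \<Rightarrow> real" where
  "deltoid_disc w = cmod w ^ 4 - 8 * Re (w ^ 3) + 18 * cmod w ^ 2 - 27"

definition unit_triple_sums :: "complex set" where
  "unit_triple_sums = {cis \<alpha> + cis \<beta> + cis (- \<alpha> - \<beta>) | \<alpha> \<beta>. True}"

lemma deltoid_cis: "deltoid \<theta> = 2 * cis \<theta> + cis (- 2 * \<theta>)"
  by (simp add: deltoid_def cis_conv_exp mult_ac)

lemma cmod_power2_cis_form:
  "cmod (of_real t * cis \<theta> + cis (-2 * \<theta>)) ^ 2 = t\<^sup>2 + 1 + 2 * t * cos (3 * \<theta>)"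
proof -
  have "cos (3 * \<theta>) = cos \<theta> * cos (2 * \<theta>) - sin \<theta> * sin (2 * \<theta>)"
    using cos_add[of \<theta> "2 * \<theta>"] by simp
  moreover have "(t * c + C)\<^sup>2 + (t * s - S)\<^sup>2 =
      t\<^sup>2 * (c\<^sup>2 + s\<^sup>2) + (C\<^sup>2 + S\<^sup>2) + 2 * t * (c * C - s * S)" for c s C S
    by (simp add: power2_eq_square algebra_simps)
  ultimately show ?thesis
    unfolding cmod_power2 by simp
qed

lemma Re_cube_cis_form:
  "Re ((of_real t * cis \<theta> + cis (-2 * \<theta>)) ^ 3) =
     t ^ 3 * cos (3 * \<theta>) + 3 * t\<^sup>2 + 3 * t * cos (3 * \<theta>) + 2 * (cos (3 * \<theta>))\<^sup>2 - 1"
proof -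
  have "(of_real t * cis \<theta> + cis (-2 * \<theta>)) ^ 3 =
      of_real t ^ 3 * cis \<theta> ^ 3 + 3 * of_real t ^ 2 * (cis \<theta> ^ 2 * cis (-2 * \<theta>))
      + 3 * of_real t * (cis \<theta> * cis (-2 * \<theta>) ^ 2) + cis (-2 * \<theta>) ^ 3"
    by (simp add: power3_eq_cube power2_eq_square algebra_simps)
  also have "cis \<theta> ^ 3 = cis (3 * \<theta>)" by (simp add: Complex.DeMoivre)
  also have "cis \<theta> ^ 2 * cis (-2 * \<theta>) = 1" by (simp add: Complex.DeMoivre cis_mult)
  also have "cis \<theta> * cis (-2 * \<theta>) ^ 2 = cis (- (3 * \<theta>))"
    by (simp add: Complex.DeMoivre cis_mult algebra_simps)
  also have "cis (-2 * \<theta>) ^ 3 = cis (- (2 * (3 * \<theta>)))"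
    by (simp add: Complex.DeMoivre algebra_simps)
  finally have "Re ((of_real t * cis \<theta> + cis (-2 * \<theta>)) ^ 3) =
      Re (of_real t ^ 3 * cis (3 * \<theta>) + 3 * of_real t ^ 2 * 1
      + 3 * of_real t * cis (- (3 * \<theta>)) + cis (- (2 * (3 * \<theta>))))" by simp
  also have "\<dots> = t ^ 3 * cos (3 * \<theta>) + 3 * t\<^sup>2 + 3 * t * cos (3 * \<theta>) + cos (2 * (3 * \<theta>))"
    by (simp flip: of_real_power)
  finally show ?thesis by (simp only: cos_double_cos)
qed

text \<open>The discriminant of \<open>(z - e\<^sup>-\<^sup>2\<^sup>i\<^sup>\<theta>)(z\<^sup>2 - t e\<^sup>i\<^sup>\<theta> z + e\<^sup>2\<^sup>i\<^sup>\<theta>)\<close>.\<close>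
lemma deltoid_disc_cis_form:
  "deltoid_disc (of_real t * cis \<theta> + cis (-2 * \<theta>)) = (t\<^sup>2 - 4) * (t - 2 * cos (3 * \<theta>))\<^sup>2"
proof -
  have "cmod w ^ 4 = (cmod w ^ 2) ^ 2" for w by simp
  then show ?thesis
    unfolding deltoid_disc_def Re_cube_cis_form cmod_power2_cis_form
    by (simp only: cmod_power2_cis_form) (simp add: power2_eq_square power3_eq_cube algebra_simps)
qed

text \<open>\<open>\<theta> \<mapsto> Im (w e\<^sup>-\<^sup>i\<^sup>\<theta> - e\<^sup>-\<^sup>3\<^sup>i\<^sup>\<theta>)\<close> changes sign under \<open>\<theta> \<mapsto> \<theta> + \<pi>\<close>, so it has a zero.\<close>
lemma exists_cis_form:
  obtains t \<theta> where "w = of_real t * cis \<theta> + cis (-2 * \<theta>)"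
proof -
  define h where "h \<theta> = Im (w * cis (- \<theta>) - cis (- 3 * \<theta>))" for \<theta>
  have cont: "continuous_on A h" for A
    unfolding h_def by (intro continuous_intros)
  have "cis (- pi) = -1" by (simp add: complex_eq_iff)
  moreover have "cis (- 3 * pi) = -1"
    using cis_mult[of "- pi" "- 2 * pi"] cis_multiple_2pi[of "-1"]  \<open>cis (- pi) = -1\<close> by simp
  ultimately have h_pi: "h pi = - h 0" unfolding h_def by simp
  obtain \<theta> where "h \<theta> = 0"
  proof (cases "h 0 \<le> 0")
    case True
    then show ?thesis using IVT'[of h 0 0 pi] h_pi cont that by (metis neg_0_le_iff_le pi_ge_zero)
  next
    case False
    then show ?thesis using IVT2'[of h pi 0 0] h_pi cont that by (metis linear neg_le_0_iff_le pi_ge_zero)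
  qed
  then have "of_real (Re (w * cis (- \<theta>) - cis (- 3 * \<theta>))) = w * cis (- \<theta>) - cis (- 3 * \<theta>)"
    unfolding h_def by (simp add: complex_eq_iff)
  then have "of_real (Re (w * cis (- \<theta>) - cis (- 3 * \<theta>))) * cis \<theta> =
      w * (cis (- \<theta>) * cis \<theta>) - cis (- 3 * \<theta>) * cis \<theta>"
    by (simp only: left_diff_distrib mult.assoc)
  moreover have "cis (- 3 * \<theta>) * cis \<theta> = cis (-2 * \<theta>)" "cis (- \<theta>) * cis \<theta> = 1"
    by (simp_all add: cis_mult)
  ultimately have "w = of_real (Re (w * cis (- \<theta>) - cis (- 3 * \<theta>))) * cis \<theta> + cis (-2 * \<theta>)"
    by (simp only: diff_eq_eq) simp
  then show thesis by (rule that)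
qed

text \<open>In the form \<open>t cis \<theta> + cis (-2 \<theta>)\<close> the discriminant has the
  sign of \<open>t^2 - 4\<close> unless its squared factor vanishes. Sums of unit triples are
  exactly the points with \<open>|t| \<le> 2\<close>, where \<open>t = 2 cos \<psi>\<close>.\<close>

lemma unit_triple_sums_eq: "unit_triple_sums = {w. deltoid_disc w \<le> 0}"
proof (intro equalityI subsetI)
  fix w assume "w \<in> unit_triple_sums"
  then obtain \<alpha> \<beta> where w: "w = cis \<alpha> + cis \<beta> + cis (- \<alpha> - \<beta>)"
    by (auto simp: unit_triple_sums_def)
  \<comment> \<open>Half-sum and half-difference turn \<open>cis \<alpha> + cis \<beta>\<close> into
    \<open>2 cos \<psi> cis \<theta>\<close>.\<close>
  define \<theta> \<psi> where "\<theta> = (\<alpha> + \<beta>) / 2" and "\<psi> = (\<alpha> - \<beta>) / 2"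
  have \<alpha>: "\<alpha> = \<theta> + \<psi>" and \<beta>: "\<beta> = \<theta> - \<psi>"
    by (simp_all add: \<theta>_def \<psi>_def field_simps)
  have "w = of_real (2 * cos \<psi>) * cis \<theta> + cis (-2 * \<theta>)"
    unfolding w \<alpha> \<beta> by (simp add: complex_eq_iff cos_add cos_diff sin_add sin_diff)
  moreover have "(2 * cos \<psi>)\<^sup>2 \<le> 4"
    using abs_square_le_1[of "cos \<psi>"] by (simp add: power_mult_distrib)
  ultimately show "w \<in> {w. deltoid_disc w \<le> 0}"
    by (simp only: deltoid_disc_cis_form mem_Collect_eq mult_le_0_iff) simp
next
  fix w assume w: "w \<in> {w. deltoid_disc w \<le> 0}"
  obtain t \<theta> where w_eq: "w = of_real t * cis \<theta> + cis (-2 * \<theta>)"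
    using exists_cis_form .
  have "\<bar>t\<bar> \<le> 2"
  \<comment> \<open>When the squared factor vanishes the discriminant says nothing about
    \<open>t^2 - 4\<close>, but then \<open>t\<close> is twice a cosine.\<close>
  proof (cases "t = 2 * cos (3 * \<theta>)")
    case True
    then show ?thesis using abs_cos_le_one[of "3 * \<theta>"] by linarith
  next
    case False
    then have "t\<^sup>2 \<le> 2\<^sup>2"
      using w unfolding w_eq deltoid_disc_cis_form mem_Collect_eq
      by (simp add: mult_le_0_iff)
    then show ?thesis using abs_le_square_iff[of t 2] by simp
  qed
  then have "cos (arccos (t / 2)) = t / 2" by (simp add: abs_le_iff)
  then have "w = cis (\<theta> + arccos (t / 2)) + cis (\<theta> - arccos (t / 2))
      + cis (- (\<theta> + arccos (t / 2)) - (\<theta> - arccos (t / 2)))"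
    unfolding w_eq by (simp add: complex_eq_iff cos_add cos_diff sin_add sin_diff)
  then show "w \<in> unit_triple_sums"
    unfolding unit_triple_sums_def by blast
qed

text \<open>The curve depends on \<theta> only through \<open>cis \<theta>\<close>, so any angle may
  be replaced by an argument in one period.\<close>

lemma range_deltoid: "deltoid ` {0..2 * pi} = range deltoid"
proof
  show "range deltoid \<subseteq> deltoid ` {0..2 * pi}"
  proof
    fix w assume "w \<in> range deltoid"
    then obtain \<theta> where w: "w = deltoid \<theta>" by blast
    define \<phi> where "\<phi> = Arg2pi (cis \<theta>)"
    have \<phi>: "0 \<le> \<phi>" "\<phi> \<le> 2 * pi"
      using Arg2pi_ge_0[of "cis \<theta>"] Arg2pi_lt_2pi[of "cis \<theta>"] by (simp_all add: \<phi>_def)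
    have "cis \<theta> = of_real (cmod (cis \<theta>)) * exp (\<i> * of_real (Arg2pi (cis \<theta>)))"
      by (rule Arg2pi_eq)
    then have cis_\<phi>: "cis \<theta> = cis \<phi>"
      unfolding \<phi>_def cis_conv_exp[of "Arg2pi _"] by (simp only: norm_cis of_real_1 mult_1)
    have deltoid_inverse: "deltoid \<theta> = 2 * cis \<theta> + inverse (cis \<theta>) ^ 2" for \<theta>
      by (simp add: deltoid_cis Complex.DeMoivre)
    then have "w = deltoid \<phi>" by (simp only: w deltoid_inverse cis_\<phi>)
    then show "w \<in> deltoid ` {0..2 * pi}" using \<phi> by auto
  qed
qed auto

text \<open>A vanishing discriminant means a double root, and a double root
  \<open>cis \<phi>\<close> gives the point \<open>deltoid \<phi>\<close>. For \<open>t = 2\<close>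
  or \<open>t = -2\<close> the two roots with sum \<open>t cis \<theta>\<close> coincide; for
  \<open>t = 2 cos (3 \<theta>)\<close> one of them equals \<open>cis (-2 \<theta>)\<close>.\<close>

lemma deltoid_curve_eq: "deltoid ` {0..2 * pi} = {w. deltoid_disc w = 0}"
  unfolding range_deltoid
proof (intro equalityI subsetI)
  fix w assume "w \<in> range deltoid"
  then obtain \<theta> where "w = deltoid \<theta>" by blast
  then have "w = of_real 2 * cis \<theta> + cis (-2 * \<theta>)" by (simp add: deltoid_cis)
  then show "w \<in> {w. deltoid_disc w = 0}"
    by (simp only: mem_Collect_eq deltoid_disc_cis_form) simp
next
  fix w assume w: "w \<in> {w. deltoid_disc w = 0}"
  obtain t \<theta> where w_eq: "w = of_real t * cis \<theta> + cis (-2 * \<theta>)"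
    using exists_cis_form .
  have "t\<^sup>2 = 2\<^sup>2 \<or> t = 2 * cos (3 * \<theta>)"
    using w unfolding w_eq deltoid_disc_cis_form mem_Collect_eq by auto
  then consider "t = 2" | "t = - 2" | "t = 2 * cos (3 * \<theta>)"
    unfolding power2_eq_iff by blast
  then show "w \<in> range deltoid"
  proof cases
    case 1
    then show ?thesis by (auto simp: w_eq deltoid_cis)
  next
    case 2
    have "deltoid (\<theta> + pi) = w"
      by (simp add: 2 w_eq deltoid_cis complex_eq_iff algebra_simps cos_add sin_add cos_diff sin_diff)
    then show ?thesis by blast
  next
    case 3
    have "of_real (2 * cos (3 * \<theta>)) * cis \<theta> = (cis (3 * \<theta>) + cis (- (3 * \<theta>))) * cis \<theta>"
      by (simp add: complex_eq_iff)
    then have "deltoid (- 2 * \<theta>) = w"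
      by (simp add: 3 w_eq deltoid_cis distrib_right cis_mult)
    then show ?thesis by blast
  qed
qed

text \<open>The increment is its value at \<open>c = 1\<close> plus
  \<open>8 (1 - c) (y^3 - x^3) \<ge> 0\<close>, so \<open>c = 1\<close> is the critical case. There
  the derivative \<open>4 x (x - 3)^2\<close> vanishes at 3, a cusp of the deltoid, and an explicit
  identity gives strictness.\<close>

lemma quartic_strict_mono:
  fixes x y c :: real
  assumes "0 \<le> x" "x < y" "c \<le> 1"
  shows "x ^ 4 - 8 * c * x ^ 3 + 18 * x\<^sup>2 < y ^ 4 - 8 * c * y ^ 3 + 18 * y\<^sup>2"
proof -
  define s where "s = x + y"
  have s: "s > 0" using assms by (simp add: s_def)
  have "s * (y ^ 4 - 8 * y ^ 3 + 18 * y\<^sup>2 - (x ^ 4 - 8 * x ^ 3 + 18 * x\<^sup>2)) =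
        (y - x) * ((y - x)\<^sup>2 * ((s - 4)\<^sup>2 + 2) + 2 * (x * y) * (s - 6)\<^sup>2)"
    unfolding s_def by (simp add: power2_eq_square power3_eq_cube power4_eq_xxxx algebra_simps)
  also have "\<dots> > 0"
  proof -
    have "(s - 4)\<^sup>2 + 2 > 0" by (rule add_nonneg_pos) auto
    then have "(y - x)\<^sup>2 * ((s - 4)\<^sup>2 + 2) > 0" using assms by simp
    moreover have "2 * (x * y) * (s - 6)\<^sup>2 \<ge> 0" using assms by simp
    ultimately have "(y - x)\<^sup>2 * ((s - 4)\<^sup>2 + 2) + 2 * (x * y) * (s - 6)\<^sup>2 > 0"
      by (rule add_pos_nonneg)
    moreover have "y - x > 0" using assms by simp
    ultimately show ?thesis by (rule mult_pos_pos[rotated])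
  qed
  finally have "y ^ 4 - 8 * y ^ 3 + 18 * y\<^sup>2 - (x ^ 4 - 8 * x ^ 3 + 18 * x\<^sup>2) > 0"
    using s by (simp add: zero_less_mult_iff)
  moreover have "(1 - c) * (y ^ 3 - x ^ 3) \<ge> 0"
    using assms by (simp add: power_mono)
  ultimately show ?thesis by (simp add: algebra_simps)
qed

text \<open>Along a ray the cosine \<open>c\<close> of three times the argument is constant and at
  most 1, so only the modulus varies in the quartic.\<close>

lemma deltoid_disc_ray_mono:
  assumes "w \<noteq> 0" "0 \<le> s" "s < t"
  shows "deltoid_disc (of_real s * w) < deltoid_disc (of_real t * w)"
proof -
  define r where "r = cmod w"
  define c where "c = Re (w ^ 3) / r ^ 3"
  have r: "r > 0" using assms by (simp add: r_def)
  have "Re (w ^ 3) \<le> r ^ 3" using complex_Re_le_cmod[of "w ^ 3"] by (simp add: r_def norm_power)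
  then have c: "c \<le> 1" using r by (simp add: c_def)
  have disc: "deltoid_disc (of_real u * w) = (u * r) ^ 4 - 8 * c * (u * r) ^ 3 + 18 * (u * r)\<^sup>2 - 27"
    if "u \<ge> 0" for u
  proof -
    have "Re ((of_real u * w) ^ 3) = u ^ 3 * Re (w ^ 3)"
      by (simp add: power_mult_distrib flip: of_real_power)
    also have "\<dots> = c * (u * r) ^ 3"
      using r by (simp add: c_def power_mult_distrib)
    finally show ?thesis
      using that by (simp add: deltoid_disc_def norm_mult r_def)
  qed
  show ?thesis
    using quartic_strict_mono[of "s * r" "t * r" c] assms r c by (simp add: disc)
qed

section \<open>Topology of the deltoid region\<close>

lemma continuous_on_deltoid_disc: "continuous_on A deltoid_disc"
  unfolding deltoid_disc_def by (intro continuous_intros)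

lemma bounded_unit_triple_sums: "bounded unit_triple_sums"
proof (rule boundedI)
  fix w assume "w \<in> unit_triple_sums"
  then obtain \<alpha> \<beta> where w: "w = cis \<alpha> + cis \<beta> + cis (- \<alpha> - \<beta>)"
    by (auto simp: unit_triple_sums_def)
  show "cmod w \<le> 3"
    unfolding w by (rule norm_triangle_le, rule add_mono[THEN order_trans, OF norm_triangle_ineq order_refl]) simp
qed

text \<open>The discriminant keeps its sign on each component of the complement of the curve. A
  negative component lies in the bounded set \<open>unit_triple_sums\<close>; from a positive point
  the outward ray avoids the curve and is unbounded.\<close>

lemma inside_deltoid: "inside (deltoid ` {0..2 * pi}) = {w. deltoid_disc w < 0}"
proof (intro equalityI subsetI)
  let ?D = "{w. deltoid_disc w = 0}"
  fix w assume w: "w \<in> {w. deltoid_disc w < 0}"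
  let ?C = "connected_component_set (- ?D) w"
  have wC: "w \<in> ?C" using w by simp
  have CD: "?C \<subseteq> - ?D" by (rule connected_component_subset)
  have "deltoid_disc v < 0" if v: "v \<in> ?C" for v
  proof (rule ccontr)
    assume "\<not> deltoid_disc v < 0"
    moreover have "connected (deltoid_disc ` ?C)"
      by (intro connected_continuous_image continuous_on_deltoid_disc connected_connected_component)
    ultimately have "0 \<in> deltoid_disc ` ?C"
      using w wC v connectedD_interval[of "deltoid_disc ` ?C" "deltoid_disc w" "deltoid_disc v" 0]
      by (simp add: imageI)
    then show False using CD by auto
  qed
  then have "?C \<subseteq> unit_triple_sums"
    unfolding unit_triple_sums_eq by fastforce
  then have "bounded ?C"
    using bounded_unit_triple_sums bounded_subset by blast
  then show "w \<in> inside (deltoid ` {0..2 * pi})"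
    using w by (simp add: inside_def deltoid_curve_eq)
next
  let ?D = "{w. deltoid_disc w = 0}"
  fix w assume "w \<in> inside (deltoid ` {0..2 * pi})"
  then have w0: "deltoid_disc w \<noteq> 0" and bdd: "bounded (connected_component_set (- ?D) w)"
    by (simp_all add: inside_def deltoid_curve_eq)
  show "w \<in> {w. deltoid_disc w < 0}"
  proof (rule ccontr)
    assume "w \<notin> {w. deltoid_disc w < 0}"
    then have pos: "deltoid_disc w > 0" using w0 by simp
    then have "w \<noteq> 0" by (auto simp: deltoid_disc_def)
    let ?R = "(\<lambda>s. of_real s * w) ` {1..}"
    have "connected ?R"
      by (intro connected_continuous_image continuous_intros) simp
    moreover have "w \<in> ?R" by (rule image_eqI[of _ _ 1]) auto
    moreover have "?R \<subseteq> - ?D"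
    proof
      fix v assume "v \<in> ?R"
      then obtain s :: real where s: "s \<ge> 1" "v = of_real s * w" by auto
      have "deltoid_disc (of_real 1 * w) \<le> deltoid_disc (of_real s * w)"
        using deltoid_disc_ray_mono[OF \<open>w \<noteq> 0\<close>, of 1 s] s(1) by (cases "s = 1") auto
      then show "v \<in> - ?D" using pos s by auto
    qed
    ultimately have "?R \<subseteq> connected_component_set (- ?D) w"
      by (intro connected_component_maximal)
    then have "bounded ?R" using bdd bounded_subset by blast
    then obtain B where B: "\<And>s. s \<ge> 1 \<Longrightarrow> cmod (of_real s * w) \<le> B"
      unfolding bounded_iff by auto
    \<comment> \<open>This parameter stays on the ray and makes the modulus at least
      \<open>B + 1\<close>.\<close>
    have "max 1 ((B + 1) / cmod w) * cmod w \<le> B"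
      using B[of "max 1 ((B + 1) / cmod w)"] by (simp add: norm_mult)
    moreover have "(B + 1) / cmod w * cmod w \<le> max 1 ((B + 1) / cmod w) * cmod w"
      by (intro mult_right_mono) auto
    ultimately show False using \<open>w \<noteq> 0\<close> by simp
  qed
qed

text \<open>Scaling a nonzero point of the closed region towards the origin makes its discriminant
  strictly negative, so the region is the closure of its strict part.\<close>

lemma H3_eq: "H3 = unit_triple_sums"
proof -
  have "closure {w. deltoid_disc w < 0} = {w. deltoid_disc w \<le> 0}"
  proof (intro equalityI)
    have "closed {w. deltoid_disc w \<le> 0}"
      by (intro closed_Collect_le continuous_on_deltoid_disc continuous_on_const)
    then show "closure {w. deltoid_disc w < 0} \<subseteq> {w. deltoid_disc w \<le> 0}"
      by (intro closure_minimal) auto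
    show "{w. deltoid_disc w \<le> 0} \<subseteq> closure {w. deltoid_disc w < 0}"
    proof clarify
      fix w assume w: "deltoid_disc w \<le> 0"
      show "w \<in> closure {w. deltoid_disc w < 0}"
      proof (cases "w = 0")
        case True
        then have "deltoid_disc w < 0" by (simp add: deltoid_disc_def)
        then show ?thesis by (intro subsetD[OF closure_subset]) simp
      next
        case False
        have "(\<lambda>n. of_real (1 - inverse (real (Suc n))) * w) \<longlonglongrightarrow> of_real (1 - 0) * w"
          by (intro tendsto_intros LIMSEQ_inverse_real_of_nat)
        moreover have "deltoid_disc (of_real (1 - inverse (real (Suc n))) * w) < 0" for n
          using deltoid_disc_ray_mono[OF False, of "1 - inverse (real (Suc n))" 1] w
          by (simp add: field_simps)
        ultimately show ?thesis
          unfolding closure_sequential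
          by (intro exI[of _ "\<lambda>n. of_real (1 - inverse (real (Suc n))) * w"]) simp
      qed
    qed
  qed
  then show ?thesis by (simp add: H3_def inside_deltoid unit_triple_sums_eq)
qed

section \<open>The ninth cyclotomic polynomial\<close>

text \<open>Eisenstein's criterion. One constant coefficient, say that of \<open>B\<close>, is prime
  to \<open>p\<close>. The lowest coefficient of \<open>A\<close> prime to \<open>p\<close> then
  produces a coefficient of the product prime to \<open>p\<close>, which can only be the leading
  one, so \<open>B\<close> is constant.\<close>

lemma eisenstein_degree:
  fixes A B :: "int poly" and p :: int
  assumes p: "prime p" and small: "\<And>i. i < degree (A * B) \<Longrightarrow> p dvd coeff (A * B) i"
    and lead: "\<not> p dvd lead_coeff (A * B)" and const: "\<not> p ^ 2 dvd coeff (A * B) 0"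
  shows "degree A = 0 \<or> degree B = 0"
proof -
  have main: "degree B = 0"
    if AB: "A * B = P" and pB: "\<not> p dvd coeff B 0" and P: "\<And>i. i < degree P \<Longrightarrow> p dvd coeff P i"
      and lead: "\<not> p dvd lead_coeff P" for A B P :: "int poly"
  proof -
    have "P \<noteq> 0" using lead by auto
    then have nz: "A \<noteq> 0" "B \<noteq> 0" using AB by auto
    have "\<not> p dvd lead_coeff A"
      using lead unfolding AB[symmetric] lead_coeff_mult by auto
    define i where "i = (LEAST i. \<not> p dvd coeff A i)"
    have i: "\<not> p dvd coeff A i"
      unfolding i_def using \<open>\<not> p dvd lead_coeff A\<close> by (rule LeastI)
    have less: "p dvd coeff A j" if "j < i" for j
      using not_less_Least that unfolding i_def by blast
    have "coeff P i = (\<Sum>j\<le>i. coeff A j * coeff B (i - j))"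
      by (simp add: AB[symmetric] coeff_mult)
    also have "\<dots> = (\<Sum>j<i. coeff A j * coeff B (i - j)) + coeff A i * coeff B 0"
      by (simp flip: lessThan_Suc_atMost)
    finally have "coeff A i * coeff B 0 = coeff P i - (\<Sum>j<i. coeff A j * coeff B (i - j))"
      by simp
    moreover have "p dvd (\<Sum>j<i. coeff A j * coeff B (i - j))"
      using less by (intro dvd_sum) auto
    moreover have "\<not> p dvd coeff A i * coeff B 0"
      using i pB p by (simp add: prime_dvd_mult_iff)
    ultimately have "\<not> p dvd coeff P i"
      using dvd_diff[of p "coeff P i"] by fastforce
    then have "degree P \<le> i" using P not_le by blast
    also have "i \<le> degree A" using i by (intro le_degree) auto
    finally show ?thesis
      using nz by (simp add: AB[symmetric] degree_mult_eq)
  qed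
  have "\<not> p dvd coeff A 0 \<or> \<not> p dvd coeff B 0"
    using const by (auto simp: coeff_mult_0 power2_eq_square intro: mult_dvd_mono)
  then show ?thesis
    using main[of A B "A * B"] main[of B A "A * B"] small lead by (auto simp: mult.commute)
qed

section \<open>Irreducibility of the ninth cyclotomic polynomial\<close>

definition cyclotomic9 :: "int poly" where
  "cyclotomic9 = [:1, 0, 0, 1, 0, 0, 1:]"

lemma poly_cyclotomic9: "poly cyclotomic9 x = x ^ 6 + x ^ 3 + 1"
  by (simp add: cyclotomic9_def power_numeral_reduce algebra_simps)

lemma degree_cyclotomic9: "degree cyclotomic9 = 6"
  by (simp add: cyclotomic9_def)

text \<open>Substituting \<open>x + 1\<close> preserves degrees and yields a polynomial that is
  Eisenstein at 3.\<close>

lemma cyclotomic9_factor_degree: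
  assumes "cyclotomic9 = A * B"
  shows "degree A = 0 \<or> degree B = 0"
proof -
  let ?s = "\<lambda>P :: int poly. pcompose P [:1, 1:]"
  have shift: "?s A * ?s B = [:3, 9, 18, 21, 15, 6, 1:]"
    unfolding pcompose_mult[symmetric] assms[symmetric]
    by (simp add: cyclotomic9_def pcompose_pCons)
  have "degree (?s A) = 0 \<or> degree (?s B) = 0"
  proof (rule eisenstein_degree)
    show "prime (3 :: int)" by simp
    show "3 dvd coeff (?s A * ?s B) i" if "i < degree (?s A * ?s B)" for i
    proof -
      have "i < 6" using that unfolding shift by simp
      then have "i \<in> {0, 1, 2, 3, 4, 5}" by auto
      then show ?thesis unfolding shift by (auto simp: numeral_eq_Suc)
    qed
  qed (simp_all add: shift)
  then show ?thesis by (simp add: degree_pcompose)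
qed

text \<open>Pseudo-division over the integers factors only a multiple of \<open>cyclotomic9\<close>.
  Gauss's lemma, as multiplicativity of primitive parts, removes the multiplier up to sign.\<close>

lemma cyclotomic9_smult_factor_degree:
  assumes "c \<noteq> 0" and AB: "smult c cyclotomic9 = A * B"
  shows "degree A = 0 \<or> degree B = 0"
proof -
  have "content cyclotomic9 = 1" by (simp add: cyclotomic9_def content_def)
  then have "primitive_part cyclotomic9 = cyclotomic9"
    using content_times_primitive_part[of cyclotomic9] by simp
  then have "primitive_part (smult c cyclotomic9) = smult (sgn c) cyclotomic9"
    by (simp add: primitive_part_smult)
  then have "smult (sgn c * sgn c) cyclotomic9 = smult (sgn c) (primitive_part A * primitive_part B)"
    by (simp add: AB primitive_part_mult)
  moreover have "sgn c * sgn c = 1" using \<open>c \<noteq> 0\<close> by (simp add: sgn_if)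
  ultimately have "cyclotomic9 = smult (sgn c) (primitive_part A) * primitive_part B"
    by simp
  from cyclotomic9_factor_degree[OF this] show ?thesis
    using \<open>c \<noteq> 0\<close> by (simp add: degree_smult_eq sgn_0_0)
qed

text \<open>A Euclidean descent: \<open>cyclotomic9\<close> is pseudo-divided by \<open>f\<close>,
  and \<open>f\<close> is replaced by the remainder. Irreducibility keeps the remainder nonzero
  until a constant is reached.\<close>

lemma cyclotomic9_bezout:
  fixes f :: "int poly"
  assumes "f \<noteq> 0" "degree f < 6"
  obtains A B R where "R \<noteq> 0" "A * f + B * cyclotomic9 = [:R:]"
proof -
  have "\<exists>A B R. R \<noteq> 0 \<and> A * f + B * cyclotomic9 = [:R:]"
    using assms
  proof (induction "degree f" arbitrary: f rule: less_induct)
    case less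
    show ?case
    proof (cases "degree f = 0")
      case True
      then obtain R where "f = [:R:]" by (metis degree_eq_zeroE)
      then show ?thesis using less.prems by (intro exI[of _ 1] exI[of _ 0] exI[of _ R]) auto
    next
      case False
      define r where "r = pseudo_mod cyclotomic9 f"
      obtain a s where a: "a \<noteq> 0" "smult a cyclotomic9 = f * s + r" and deg: "r = 0 \<or> degree r < degree f"
        using pseudo_mod[OF less.prems(1), of cyclotomic9] unfolding r_def by blast
      \<comment> \<open>A zero remainder would make \<open>f\<close>, of degree strictly between 0
        and 6, a factor of a multiple of \<open>cyclotomic9\<close>.\<close>
      have "r \<noteq> 0"
      proof
        assume "r = 0"
        then have eq: "smult a cyclotomic9 = f * s" using a by simp
        then have "degree s = 0"
          using cyclotomic9_smult_factor_degree[OF a(1) eq] False by simp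
        moreover have "degree (f * s) \<le> degree f + degree s" by (rule degree_mult_le)
        moreover have "degree (f * s) = 6"
          using a(1) by (simp add: eq[symmetric] degree_cyclotomic9)
        ultimately show False using less.prems(2) by simp
      qed
      then obtain A B R where "R \<noteq> 0" and R: "A * r + B * cyclotomic9 = [:R:]"
        using less.hyps[of r] deg less.prems(2) by force
      have "r = smult a cyclotomic9 - f * s" using a by simp
      moreover have "(- A * s) * f + (smult a A + B) * cyclotomic9 =
          A * (smult a cyclotomic9 - f * s) + B * cyclotomic9"
        by (simp add: algebra_simps)
      ultimately have "(- A * s) * f + (smult a A + B) * cyclotomic9 = [:R:]"
        using R by metis
      then show ?thesis using \<open>R \<noteq> 0\<close> by blast
    qed
  qed
  then show thesis using that by blast
qed

text \<open>A resultant argument: if \<open>q\<close> divides both \<open>f(g)\<close> and \<open>\<Phi>\<^sub>9(g)\<close>, it divides a nonzero integer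
  depending only on \<open>f\<close>.\<close>
lemma eventually_not_dvd_poly:
  fixes f :: "int poly"
  assumes "f \<noteq> 0" "degree f < 6"
  shows "\<forall>\<^sub>F q in sequentially. \<forall>g. [g ^ 6 + g ^ 3 + 1 = 0] (mod int q) \<longrightarrow> \<not> int q dvd poly f g"
proof -
  obtain A B R where "R \<noteq> 0" and R: "A * f + B * cyclotomic9 = [:R:]"
    using cyclotomic9_bezout[OF assms] .
  \<comment> \<open>\<open>R\<close> comes from \<open>f\<close> alone, so the threshold
    \<open>|R|\<close> serves every \<open>g\<close> at once.\<close>
  have not_dvd: "\<not> int q dvd poly f g" if "q > nat \<bar>R\<bar>" and g: "[g ^ 6 + g ^ 3 + 1 = 0] (mod int q)" for q g
  proof
    assume "int q dvd poly f g"
    moreover have "int q dvd poly cyclotomic9 g"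
      using g by (simp add: poly_cyclotomic9 cong_0_iff)
    ultimately have "int q dvd poly (A * f + B * cyclotomic9) g" by simp
    then have "int q dvd R" by (simp add: R)
    then show False using dvd_imp_le_int[OF \<open>R \<noteq> 0\<close>] that(1) by fastforce
  qed
  from eventually_gt_at_top[of "nat \<bar>R\<bar>"] show ?thesis
    by (rule eventually_mono) (use not_dvd in blast)
qed

section \<open>Density of power multiples\<close>

lemma add_char_cis: "add_char x = cis (2 * pi * x)"
  by (simp add: add_char_def cis_conv_exp mult_ac)

lemma norm_add_char [simp]: "cmod (add_char x) = 1"
  by (simp add: add_char_cis)

lemma add_char_0 [simp]: "add_char 0 = 1"
  by (simp add: add_char_cis)

lemma add_char_add: "add_char (x + y) = add_char x * add_char y"
  by (simp add: add_char_cis cis_mult algebra_simps)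

lemma add_char_minus: "add_char (- x) = cnj (add_char x)"
  by (simp add: add_char_cis cis_cnj)

lemma add_char_of_int [simp]: "add_char (of_int n) = 1"
  using cis_multiple_2pi[of "of_int n"] by (simp add: add_char_cis mult.commute)

lemma add_char_power: "add_char x ^ n = add_char (of_nat n * x)"
  by (simp add: add_char_cis Complex.DeMoivre mult_ac)

lemma add_char_prod: "(\<Prod>i\<in>A. add_char (f i)) = add_char (\<Sum>i\<in>A. f i)"
  by (induction A rule: infinite_finite_induct) (simp_all add: add_char_add)

lemma add_char_eq_1_imp_Ints:
  assumes "add_char x = 1"
  shows "x \<in> \<int>"
proof -
  have "cos (2 * pi * x) = 1" using assms by (simp add: add_char_cis complex_eq_iff)
  then obtain n where "2 * pi * x = 2 * pi * of_int n"
    by (auto simp: cos_one_2pi_int mult_ac)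
  then show ?thesis by simp
qed

lemma add_char_cong:
  assumes "[m = n] (mod int q)" "q > 0"
  shows "add_char (of_int m / of_nat q) = add_char (of_int n / of_nat q)"
proof -
  obtain k where "m = n + int q * k"
    using assms(1) by (metis cong_iff_lin cong_sym)
  then have "of_int m / of_nat q = of_int n / of_nat q + (of_int k :: real)"
    using assms(2) by (simp add: field_simps)
  then show ?thesis by (simp add: add_char_add)
qed

text \<open>A geometric sum whose ratio is a \<open>q\<close>-th root of unity, equal to 1 exactly
  when \<open>q\<close> divides \<open>n\<close>.\<close>

lemma sum_add_char:
  assumes "q > 0"
  shows "(\<Sum>a<q. add_char (of_nat a * of_int n / of_nat q)) = (if int q dvd n then of_nat q else 0)"
proof -
  let ?z = "add_char (of_int n / of_nat q)"
  have sum: "(\<Sum>a<q. add_char (of_nat a * of_int n / of_nat q)) = (\<Sum>a<q. ?z ^ a)"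
    by (simp add: add_char_power)
  show ?thesis
  proof (cases "int q dvd n")
    case True
    then have "?z = 1" using add_char_cong[of n 0 q] assms by (simp add: cong_0_iff)
    then show ?thesis using True by (simp add: sum)
  next
    case False
    have "?z \<noteq> 1"
    proof
      assume "?z = 1"
      then obtain k where "(of_int n / of_nat q :: real) = of_int k"
        using add_char_eq_1_imp_Ints by (auto elim: Ints_cases)
      then have "real_of_int n = of_int (k * int q)"
        using assms by (simp add: field_simps)
      then have "n = k * int q" by (simp only: of_int_eq_iff)
      then show False using False by simp
    qed
    moreover have "?z ^ q = 1" using assms by (simp add: add_char_power)
    ultimately show ?thesis using False by (simp add: sum sum_gp_strict)
  qed
qed

text \<open>\<open>|z + c|\<^sup>2\<^sup>N\<close> as a trigonometric polynomial; the term \<open>j = N\<close> is constant in \<open>z\<close>.\<close>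
lemma cmod_add_power_eq_sum:
  assumes "cmod z = 1" "cmod c = 1"
  shows "of_real (cmod (z + c) ^ (2 * N)) =
    (\<Sum>j\<le>2 * N. of_nat ((2 * N) choose j) * (cnj c ^ j * c ^ N) * (z ^ j * cnj z ^ N))"
proof -
  have z: "z * cnj z = 1" and c: "c * cnj c = 1"
    using assms by (simp_all add: complex_norm_square[symmetric])
  \<comment> \<open>With the squared modulus written as \<open>(z cnj c + 1)^2\<close> times a unit,
    a single binomial expansion gives its \<open>N\<close>-th power.\<close>
  have "(z + c) * cnj (z + c) = (z * cnj c + 1)\<^sup>2 * (cnj z * c)"
  proof -
    have "(z * cnj c + 1)\<^sup>2 * (cnj z * c) =
        (z * cnj z) * (c * cnj c) * (z * cnj c) + 2 * ((z * cnj z) * (c * cnj c)) + cnj z * c"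
      by (simp add: power2_eq_square algebra_simps)
    also have "\<dots> = z * cnj z + z * cnj c + c * cnj c + c * cnj z"
      by (simp add: z c)
    finally show ?thesis by (simp add: algebra_simps)
  qed
  moreover have "of_real (cmod (z + c) ^ (2 * N)) = ((z + c) * cnj (z + c)) ^ N"
    by (simp only: power_mult of_real_power complex_norm_square[symmetric])
  ultimately have "of_real (cmod (z + c) ^ (2 * N)) = (z * cnj c + 1) ^ (2 * N) * (cnj z * c) ^ N"
    by (simp only: power_mult_distrib power_mult)
  also have "\<dots> = (\<Sum>j\<le>2 * N. of_nat ((2 * N) choose j) * (z * cnj c) ^ j * (cnj z * c) ^ N)"
    by (simp add: binomial_ring sum_distrib_right)
  finally show ?thesis by (simp add: power_mult_distrib mult_ac)
qed

text \<open>The central coefficient is the largest of \<open>2N + 1\<close> entries with sum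
  \<open>4^N\<close>. Hence the constant term of \<open>|z + c|^(2N)\<close> is smaller than its
  maximum only by a polynomial factor.\<close>

lemma four_power_le_central_binomial: "4 ^ N \<le> (2 * N + 1) * ((2 * N) choose N)"
proof -
  have "(2::nat) ^ (2 * N) = (\<Sum>j\<le>2 * N. (2 * N) choose j)"
    by (rule choose_row_sum[symmetric])
  also have "\<dots> \<le> (\<Sum>j\<le>2 * N. (2 * N) choose N)"
    using binomial_maximum'[of N] by (intro sum_mono) simp
  finally show ?thesis by (simp add: power_mult)
qed

text \<open>Records the frequency of a monomial: for \<open>z k = add_char (a * g ^ k / q)\<close>
  the product of \<open>z k ^ m k * cnj (z k) ^ N\<close> is \<open>add_char (a * P(g) / q)\<close>
  with \<open>P\<close> this polynomial. The constant term corresponds to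
  \<open>P = 0\<close>.\<close>

definition deviation_poly :: "nat \<Rightarrow> (nat \<Rightarrow> nat) \<Rightarrow> int poly" where
  "deviation_poly N m = (\<Sum>k<6. monom (int (m k) - int N) k)"

lemma coeff_deviation_poly:
  "coeff (deviation_poly N m) k = (if k < 6 then int (m k) - int N else 0)"
  by (simp add: deviation_poly_def coeff_sum)

lemma poly_deviation_poly: "poly (deviation_poly N m) g = (\<Sum>k<6. (int (m k) - int N) * g ^ k)"
  by (simp add: deviation_poly_def poly_sum poly_monom)

lemma degree_deviation_poly: "degree (deviation_poly N m) < 6"
proof -
  have "degree (deviation_poly N m) \<le> 5"
    by (rule degree_le) (simp add: coeff_deviation_poly)
  then show ?thesis by simp
qed

text \<open>For fixed \<open>N\<close> there are finitely many exponent vectors \<open>m\<close>, so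
  their thresholds in \<open>q\<close> combine into one, still uniform in \<open>g\<close>.\<close>

lemma eventually_not_dvd_deviation:
  "\<forall>\<^sub>F q in sequentially. \<forall>g. [g ^ 6 + g ^ 3 + 1 = 0] (mod int q) \<longrightarrow>
     (\<forall>m \<in> PiE {..<6} (\<lambda>_. {..2 * N}). int q dvd poly (deviation_poly N m) g \<longrightarrow> (\<forall>k<6. m k = N))"
proof -
  have "\<forall>\<^sub>F q in sequentially. \<forall>m \<in> PiE {..<6} (\<lambda>_. {..2 * N}).
      \<forall>g. [g ^ 6 + g ^ 3 + 1 = 0] (mod int q) \<longrightarrow> int q dvd poly (deviation_poly N m) g \<longrightarrow> (\<forall>k<6. m k = N)"
  proof (intro eventually_ball_finite ballI)
    fix m
    show "\<forall>\<^sub>F q in sequentially. \<forall>g. [g ^ 6 + g ^ 3 + 1 = 0] (mod int q) \<longrightarrow>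
        int q dvd poly (deviation_poly N m) g \<longrightarrow> (\<forall>k<6. m k = N)"
    proof (cases "deviation_poly N m = 0")
      case True
      then have "\<forall>k<6. m k = N"
        using coeff_deviation_poly[of N m] by (metis coeff_0 eq_iff_diff_eq_0 of_nat_eq_iff)
      then show ?thesis by simp
    next
      case False
      then show ?thesis
        using eventually_not_dvd_poly[OF False degree_deviation_poly] by (auto elim!: eventually_mono)
    qed
  qed (simp add: finite_PiE)
  then show ?thesis by (rule eventually_mono) blast
qed

text \<open>Expanding the six factors gives one frequency per exponent vector. Summing over
  \<open>a\<close> removes every frequency not divisible by \<open>q\<close>, which by
  \<open>indep\<close> leaves only the constant term.\<close>

lemma mean_of_cmod_powers:
  fixes c :: "nat \<Rightarrow> complex"
  assumes "q > 0"
    and c: "\<And>k. k < 6 \<Longrightarrow> cmod (c k) = 1"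
    and indep: "\<And>m. m \<in> PiE {..<6} (\<lambda>_. {..2 * N}) \<Longrightarrow> int q dvd poly (deviation_poly N m) g \<Longrightarrow>
      \<forall>k<6. m k = N"
  shows "(\<Sum>a<q. \<Prod>k<6. cmod (add_char (of_int (int a * g ^ k) / of_nat q) + c k) ^ (2 * N)) =
    real q * real ((2 * N) choose N) ^ 6"
proof -
  define z where "z a k = add_char (of_int (int a * g ^ k) / of_nat q)" for a k
  define M where "M = PiE {..<6::nat} (\<lambda>_. {..2 * N})"
  define C where "C m = (\<Prod>k<6. of_nat ((2 * N) choose m k) * (cnj (c k) ^ m k * c k ^ N))" for m
  \<comment> \<open>Members of \<open>PiE\<close> are \<open>undefined\<close> outside the index
    set, so the constant vector is restricted in order to lie in \<open>M\<close>.\<close>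
  define m0 where "m0 = restrict (\<lambda>_. N) {..<6::nat}"
  have [simp]: "finite M" by (simp add: M_def finite_PiE)
  have cc: "c k * cnj (c k) = 1" if "k < 6" for k
    using c[OF that] by (simp add: complex_norm_square[symmetric])
  have "m0 \<in> M" by (simp add: m0_def M_def)
  have zz: "(\<Prod>k<6. z a k ^ m k * cnj (z a k) ^ N) =
      add_char (of_nat a * of_int (poly (deviation_poly N m) g) / of_nat q)" for a m
  proof -
    have "z a k ^ m k * cnj (z a k) ^ N =
        add_char (of_nat a * of_int ((int (m k) - int N) * g ^ k) / of_nat q)" for k
      by (simp add: z_def add_char_minus[symmetric] add_char_power add_char_add[symmetric] algebra_simps
          diff_divide_distrib)
    then show ?thesis
      by (simp add: add_char_prod poly_deviation_poly sum_distrib_left sum_divide_distrib)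
  qed
  have "of_real (\<Sum>a<q. \<Prod>k<6. cmod (z a k + c k) ^ (2 * N)) =
      (\<Sum>a<q. \<Prod>k<6. \<Sum>j\<le>2 * N.
        of_nat ((2 * N) choose j) * (cnj (c k) ^ j * c k ^ N) * (z a k ^ j * cnj (z a k) ^ N))"
    unfolding of_real_sum of_real_prod
    using c by (intro sum.cong prod.cong refl cmod_add_power_eq_sum) (simp_all add: z_def)
  also have "\<dots> = (\<Sum>a<q. \<Sum>m\<in>M. \<Prod>k<6.
        of_nat ((2 * N) choose m k) * (cnj (c k) ^ m k * c k ^ N) * (z a k ^ m k * cnj (z a k) ^ N))"
    unfolding M_def by (intro sum.cong refl prod_sum_PiE) auto
  also have "\<dots> = (\<Sum>a<q. \<Sum>m\<in>M. C m * (\<Prod>k<6. z a k ^ m k * cnj (z a k) ^ N))"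
    by (simp only: C_def prod.distrib)
  also have "\<dots> = (\<Sum>m\<in>M. C m * (\<Sum>a<q. add_char (of_nat a * of_int (poly (deviation_poly N m) g) / of_nat q)))"
    by (subst sum.swap) (simp only: zz sum_distrib_left)
  also have "\<dots> = (\<Sum>m\<in>M. C m * (if int q dvd poly (deviation_poly N m) g then of_nat q else 0))"
    by (simp only: sum_add_char[OF assms(1)])
  also have "\<dots> = (\<Sum>m\<in>{m0}. C m * (if int q dvd poly (deviation_poly N m) g then of_nat q else 0))"
  proof (rule sum.mono_neutral_right)
    show "\<forall>m \<in> M - {m0}. C m * (if int q dvd poly (deviation_poly N m) g then of_nat q else 0) = 0"
    proof
      fix m assume m: "m \<in> M - {m0}"
      have "\<not> int q dvd poly (deviation_poly N m) g"
      proof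
        assume "int q dvd poly (deviation_poly N m) g"
        then have "\<forall>k<6. m k = N" using indep m by (simp add: M_def)
        moreover have "m \<in> PiE {..<6} (\<lambda>_. {..2 * N})" "m0 \<in> PiE {..<6} (\<lambda>_. {..2 * N})"
          using m \<open>m0 \<in> M\<close> by (simp_all add: M_def)
        ultimately have "m = m0" by (intro PiE_ext) (auto simp: m0_def)
        then show False using m by simp
      qed
      then show "C m * (if int q dvd poly (deviation_poly N m) g then of_nat q else 0) = 0" by simp
    qed
  qed (use \<open>m0 \<in> M\<close> in auto)
  also have "\<dots> = C m0 * of_nat q"
    by (simp add: poly_deviation_poly m0_def)
  \<comment> \<open>In the constant term each unit \<open>c k\<close> cancels against its
    conjugate.\<close>
  also have "C m0 = (\<Prod>k<6::nat. of_nat ((2 * N) choose N))"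
    unfolding C_def m0_def using cc
    by (intro prod.cong refl) (simp add: power_mult_distrib[symmetric] mult.commute)
  also have "\<dots> * of_nat q = of_real (real q * real ((2 * N) choose N) ^ 6)"
    by simp
  finally show ?thesis unfolding z_def of_real_eq_iff .
qed

text \<open>The parallelogram law; it turns closeness of \<open>z\<close> to \<open>c\<close> into
  largeness of \<open>|z + c|\<close>.\<close>

lemma cmod_add_power2:
  assumes "cmod z = 1" "cmod c = 1"
  shows "cmod (z + c) ^ 2 = 4 - cmod (z - c) ^ 2"
proof -
  have "(Re z)\<^sup>2 + (Im z)\<^sup>2 = 1" "(Re c)\<^sup>2 + (Im c)\<^sup>2 = 1"
    using assms by (simp_all flip: cmod_power2)
  then show ?thesis
    unfolding cmod_power2 by (simp add: power2_eq_square algebra_simps)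
qed

text \<open>Exponential decay beats the polynomial loss \<open>2N + 1\<close>, incurred once for
  each of six coordinates.\<close>

lemma exists_power_small:
  fixes r :: real
  assumes "0 \<le> r" "r < 1"
  obtains N :: nat where "r ^ N * (2 * real N + 1) ^ 6 < 1"
proof -
  have "(\<lambda>N. r ^ N * (2 * real N + 1) ^ 6) \<longlonglongrightarrow> 0"
  proof (cases "r = 0")
    case True
    show ?thesis
      by (rule tendsto_eventually) (use eventually_gt_at_top[of 0] in \<open>auto elim: eventually_mono simp: True\<close>)
  next
    case False
    then have "r > 0" using assms by simp
    then show ?thesis using assms by real_asymp
  qed
  then have "\<forall>\<^sub>F N in sequentially. r ^ N * (2 * real N + 1) ^ 6 < 1"
    by (rule order_tendstoD) simp
  then show thesis using that by (auto simp: eventually_sequentially)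
qed

text \<open>
  Each factor \<open>|z\<^sub>k + c\<^sub>k|\<^sup>2 / 4\<close> is at most 1, and bounded away from 1 when \<open>z\<^sub>k\<close> is far from \<open>c\<^sub>k\<close>; the mean
  of the product of their \<open>N\<close>-th powers decays only polynomially in \<open>N\<close>.
\<close>
lemma dense_power_multiples:
  fixes \<delta> :: real
  assumes "\<delta> > 0"
  shows "\<forall>\<^sub>F q in sequentially. \<forall>g. [g ^ 6 + g ^ 3 + 1 = 0] (mod int q) \<longrightarrow>
    (\<forall>c. (\<forall>k<6. cmod (c k) = 1) \<longrightarrow>
      (\<exists>a<q. \<forall>k<6. cmod (add_char (of_int (int a * g ^ k) / of_nat q) - c k) < \<delta>))"
proof -
  \<comment> \<open>Distance at least \<delta> from \<open>c k\<close> forces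
    \<open>|z k + c k|^2 \<le> 4 - \<delta>^2\<close>, hence at most \<open>4 r\<close>; the maximum
    with 0 covers \<delta> > 2.\<close>
  define r where "r = max 0 (1 - \<delta>\<^sup>2 / 4)"
  have r: "0 \<le> r" "r < 1" using assms by (auto simp: r_def)
  \<comment> \<open>\<open>N\<close> depends on \<delta> only, so the finitely many frequencies to
    exclude are fixed before \<open>q\<close>, \<open>g\<close> and \<open>c\<close>.\<close>
  obtain N :: nat where N: "r ^ N * (2 * real N + 1) ^ 6 < 1"
    using exists_power_small[OF r] .
  have "\<exists>a<q. \<forall>k<6. cmod (add_char (of_int (int a * g ^ k) / of_nat q) - c k) < \<delta>"
    if "q > 0" and c: "\<forall>k<6. cmod (c k) = 1"
      and indep: "\<forall>m \<in> PiE {..<6} (\<lambda>_. {..2 * N}). int q dvd poly (deviation_poly N m) g \<longrightarrow> (\<forall>k<6. m k = N)"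
    for q g and c :: "nat \<Rightarrow> complex"
  proof (rule ccontr)
    define z where "z a k = add_char (of_int (int a * g ^ k) / of_nat q)" for a k
    have z [simp]: "cmod (z a k) = 1" for a k by (simp add: z_def)
    assume "\<not> (\<exists>a<q. \<forall>k<6. cmod (add_char (of_int (int a * g ^ k) / of_nat q) - c k) < \<delta>)"
    then have far: "\<exists>k<6. \<delta> \<le> cmod (z a k - c k)" if "a < q" for a
      using that unfolding z_def by (meson not_less)
    \<comment> \<open>One far coordinate contributes at most \<open>(4 r)^N\<close>, the other five
      at most \<open>4^N\<close> each.\<close>
    have bound: "(\<Prod>k<6. cmod (z a k + c k) ^ (2 * N)) \<le> (4 ^ N) ^ 6 * r ^ N" if "a < q" for a
    proof -
      obtain k0 where k0: "k0 < 6" "\<delta> \<le> cmod (z a k0 - c k0)" using far \<open>a < q\<close> by blast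
      have "\<delta>\<^sup>2 \<le> (cmod (z a k0 - c k0))\<^sup>2"
        using k0 assms by (intro power_mono) auto
      then have "(cmod (z a k0 + c k0))\<^sup>2 \<le> 4 * r"
      proof -
        have "1 - \<delta>\<^sup>2 / 4 \<le> r" unfolding r_def by (rule max.cobounded2)
        moreover have "(cmod (z a k0 + c k0))\<^sup>2 = 4 - (cmod (z a k0 - c k0))\<^sup>2"
          using c k0 by (intro cmod_add_power2) auto
        ultimately show ?thesis using \<open>\<delta>\<^sup>2 \<le> _\<close> by simp
      qed
      then have le_r: "cmod (z a k0 + c k0) ^ (2 * N) \<le> (4 * r) ^ N"
        unfolding power_mult by (intro power_mono) auto
      have le_4: "cmod (z a k + c k) ^ (2 * N) \<le> 4 ^ N" if "k < 6" for k
      proof -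
        have "(cmod (z a k + c k))\<^sup>2 = 4 - (cmod (z a k - c k))\<^sup>2"
          using c that by (intro cmod_add_power2) auto
        then have "(cmod (z a k + c k))\<^sup>2 \<le> 4" by simp
        then show ?thesis unfolding power_mult by (rule power_mono) simp
      qed
      have "(\<Prod>k<6. cmod (z a k + c k) ^ (2 * N)) =
          cmod (z a k0 + c k0) ^ (2 * N) * (\<Prod>k\<in>{..<6} - {k0}. cmod (z a k + c k) ^ (2 * N))"
        using k0 by (intro prod.remove) auto
      also have "\<dots> \<le> (4 * r) ^ N * (\<Prod>k\<in>{..<6} - {k0}. 4 ^ N)"
        using le_r le_4 r by (intro mult_mono prod_mono prod_nonneg) auto
      also have "\<dots> = (4 ^ N) ^ 6 * r ^ N"
        using k0 by (simp add: power_mult_distrib power_numeral_reduce)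
      finally show ?thesis .
    qed
    have "real q * real ((2 * N) choose N) ^ 6 = (\<Sum>a<q. \<Prod>k<6. cmod (z a k + c k) ^ (2 * N))"
      unfolding z_def using that by (intro mean_of_cmod_powers[symmetric]) auto
    also have "\<dots> \<le> (\<Sum>a<q. (4 ^ N) ^ 6 * r ^ N)"
      by (intro sum_mono bound) simp
    finally have "real q * real ((2 * N) choose N) ^ 6 \<le> real q * ((4 ^ N) ^ 6 * r ^ N)" by simp
    then have "real ((2 * N) choose N) ^ 6 \<le> (4 ^ N) ^ 6 * r ^ N"
      using \<open>q > 0\<close> by simp
    \<comment> \<open>Once \<open>4^N\<close> is bounded through the central binomial coefficient,
      that coefficient cancels and the choice of \<open>N\<close> is contradicted.\<close>
    also have "\<dots> \<le> (real ((2 * N + 1) * ((2 * N) choose N))) ^ 6 * r ^ N"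
    proof (intro mult_right_mono power_mono)
      have "real (4 ^ N) \<le> real ((2 * N + 1) * ((2 * N) choose N))"
        using four_power_le_central_binomial by (simp only: of_nat_le_iff)
      then show "4 ^ N \<le> real ((2 * N + 1) * ((2 * N) choose N))" by simp
    qed (use r in auto)
    also have "real ((2 * N + 1) * ((2 * N) choose N)) = (2 * real N + 1) * real ((2 * N) choose N)"
      by (simp only: of_nat_mult of_nat_add of_nat_numeral of_nat_1)
    also have "\<dots> ^ 6 * r ^ N = real ((2 * N) choose N) ^ 6 * (r ^ N * (2 * real N + 1) ^ 6)"
      by (simp only: power_mult_distrib mult_ac)
    also have "\<dots> < real ((2 * N) choose N) ^ 6 * 1"
      using N by (intro mult_strict_left_mono) auto
    finally show False by simp
  qed
  then show ?thesis
    using eventually_conj[OF eventually_gt_at_top[of 0] eventually_not_dvd_deviation[of N]]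
    by (auto elim!: eventually_mono)
qed

section \<open>Ninth roots of unity modulo prime powers\<close>

text \<open>In \<open>g^9 - 1 = (g^3 - 1) (g^6 + g^3 + 1)\<close> a common divisor of the factors
  divides 3, so \<open>p\<close> cannot divide both. The whole power \<open>p^n\<close> then divides
  one factor, and the first is excluded.\<close>

lemma dvd_cyclotomic9_value:
  fixes g :: int and p n :: nat
  assumes "prime p" "p \<noteq> 3" "[g ^ 9 = 1] (mod int (p ^ n))" "[g ^ 3 \<noteq> 1] (mod int (p ^ n))"
  shows "[g ^ 6 + g ^ 3 + 1 = 0] (mod int (p ^ n))"
proof -
  have p: "prime (int p)" using assms by simp
  have "g ^ 9 - 1 = (g ^ 3 - 1) * (g ^ 6 + g ^ 3 + 1)"
    by (simp add: algebra_simps flip: power_add)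
  then have dvd: "int p ^ n dvd (g ^ 3 - 1) * (g ^ 6 + g ^ 3 + 1)"
    using assms(3) by (simp add: cong_iff_dvd_diff)
  have "\<not> (int p dvd g ^ 3 - 1 \<and> int p dvd g ^ 6 + g ^ 3 + 1)"
  proof
    assume *: "int p dvd g ^ 3 - 1 \<and> int p dvd g ^ 6 + g ^ 3 + 1"
    have "3 = (g ^ 6 + g ^ 3 + 1) - (g ^ 3 - 1) * (g ^ 3 + 2)"
      by (simp add: algebra_simps flip: power_add)
    then have "int p dvd 3" using * by (metis dvd_diff dvd_mult2)
    then have "p dvd 3" by (metis int_dvd_int_iff of_nat_numeral)
    then show False using assms(1,2) primes_dvd_imp_eq[of p 3] by simp
  qed
  then have "coprime (int p ^ n) (g ^ 3 - 1) \<or> coprime (int p ^ n) (g ^ 6 + g ^ 3 + 1)"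
    using p by (metis coprime_power_left_iff prime_imp_coprime)
  then show ?thesis
    using dvd assms(4) by (auto simp: cong_iff_dvd_diff coprime_dvd_mult_right_iff coprime_dvd_mult_left_iff)
qed

text \<open>The units modulo \<open>p^\<alpha>\<close> form a cyclic group of order divisible by 9;
  a primitive root raised to one ninth of that order generates the ninth roots of unity.\<close>

lemma exists_ninth_root_generator:
  fixes p \<alpha> :: nat
  assumes p: "prime p" "[p = 1] (mod 9)" and \<alpha>: "\<alpha> \<ge> 1"
  obtains g where "[int g ^ 6 + int g ^ 3 + 1 = 0] (mod int (p ^ \<alpha>))"
    and "bij_betw (\<lambda>k. g ^ k mod p ^ \<alpha>) {..<9} {u. u < p ^ \<alpha> \<and> coprime u (p ^ \<alpha>) \<and> [u ^ 9 = 1] (mod p ^ \<alpha>)}"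
proof -
  define q where "q = p ^ \<alpha>"
  have p_mod: "p mod 9 = 1" using p(2) by (simp add: cong_def)
  have p_ge: "p > 1" using p(1) prime_gt_1_nat by blast
  have q: "q > 1" using p_ge \<alpha> by (simp add: q_def one_less_power del: One_nat_def)
  \<comment> \<open>Oddness gives a primitive root; \<open>p \<noteq> 3\<close> gives the cyclotomic
    congruence for an element of order 9.\<close>
  have "p \<noteq> 2" "p \<noteq> 3" using p_mod by auto
  then have "odd p" using p(1) primes_dvd_imp_eq two_is_prime_nat by blast
  then obtain r where "\<forall>k>0. residue_primroot (p ^ k) r"
    using residue_primroot_odd_prime_power_exists p(1) by blast
  then have r: "residue_primroot q r" using \<alpha> by (simp add: q_def)
  then have cop: "coprime q r" and ord: "ord q r = totient q"
    by (simp_all add: residue_primroot_def)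
  have "9 dvd p - 1" using p_mod p_ge by (metis dvd_minus_mod)
  then have "9 dvd totient q"
    using p(1) \<alpha> by (simp add: q_def totient_prime_power)
  then obtain t where t: "totient q = 9 * t" ..
  have "t > 0" using t q by (cases "t = 0") auto
  have pow_eq: "[r ^ i = r ^ j] (mod q) \<longleftrightarrow> [i = j] (mod 9 * t)" for i j
    using order_divides_expdiff[OF cop] by (simp add: ord t)
  define g where "g = r ^ t"
  have g_pow: "g ^ k = r ^ (t * k)" for k by (simp add: g_def power_mult)
  have g_eq: "[g ^ i = g ^ j] (mod q) \<longleftrightarrow> [i = j] (mod 9)" for i j
    unfolding g_pow pow_eq using \<open>t > 0\<close>
    by (simp add: cong_def mult.commute[of 9] mult_mod_right[symmetric])
  have "[int (g ^ 9) = int 1] (mod int q)" "[int (g ^ 3) \<noteq> int 1] (mod int q)"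
    unfolding cong_int_iff using g_eq[of 9 0] g_eq[of 3 0] by (simp_all add: cong_def)
  then have "[int g ^ 6 + int g ^ 3 + 1 = 0] (mod int q)"
    unfolding q_def by (intro dvd_cyclotomic9_value p(1) \<open>p \<noteq> 3\<close>) simp_all
  moreover have "bij_betw (\<lambda>k. g ^ k mod q) {..<9} {u. u < q \<and> coprime u q \<and> [u ^ 9 = 1] (mod q)}"
    unfolding bij_betw_def
  proof (intro conjI equalityI subsetI)
    show "inj_on (\<lambda>k. g ^ k mod q) {..<9}"
      by (intro inj_onI) (metis cong_def cong_less_modulus_unique_nat g_eq lessThan_iff)
  next
    fix u assume "u \<in> (\<lambda>k. g ^ k mod q) ` {..<9}"
    then obtain k where u: "u = g ^ k mod q" by blast
    have "coprime u q"
      using cop q by (simp add: u g_def coprime_commute[of _ q])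
    moreover have "[u ^ 9 = g ^ (9 * k)] (mod q)"
      by (simp add: u cong_def power_mod mult.commute flip: power_mult)
    moreover have "[g ^ (9 * k) = g ^ 0] (mod q)"
      unfolding g_eq by (simp add: cong_def)
    ultimately show "u \<in> {u. u < q \<and> coprime u q \<and> [u ^ 9 = 1] (mod q)}"
      using q by (auto simp: u intro: cong_trans)
  next
    fix u assume "u \<in> {u. u < q \<and> coprime u q \<and> [u ^ 9 = 1] (mod q)}"
    then have u: "u < q" "coprime u q" "[u ^ 9 = 1] (mod q)" by auto
    have "u \<noteq> 0" using u(2) q by (cases "u = 0") auto
    then have "u \<in> totatives q" using u by (simp add: totatives_def)
    then obtain k where k: "u = r ^ k mod q"
      using residue_primroot_is_generator[OF q r] by (auto simp: bij_betw_def)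
    have "[r ^ (9 * k) = u ^ 9] (mod q)"
      by (simp add: k cong_def power_mod mult.commute flip: power_mult)
    then have "[r ^ (9 * k) = r ^ 0] (mod q)"
      using u(3) by (simp add: cong_trans)
    then have "[9 * k = 0] (mod 9 * t)" unfolding pow_eq .
    then have "9 * t dvd 9 * k" by (simp only: cong_0_iff)
    then obtain j where j: "k = t * j" by auto
    have "[g ^ (j mod 9) = g ^ j] (mod q)" by (simp add: g_eq)
    then have "u = g ^ (j mod 9) mod q" by (simp add: k j g_pow cong_def)
    then show "u \<in> (\<lambda>k. g ^ k mod q) ` {..<9}" by auto
  qed
  ultimately show thesis using that by (simp add: q_def)
qed

text \<open>As \<open>g^9 = 1\<close> modulo \<open>q\<close>, the inverse of \<open>g^k\<close> is
  \<open>g^(8k)\<close>. The enumeration is over naturals and \<open>K\<close> sums over integers,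
  so the units are transported first.\<close>

lemma K9_eq_sum:
  assumes "q > 0" and g: "[int g ^ 6 + int g ^ 3 + 1 = 0] (mod int q)"
    and bij: "bij_betw (\<lambda>k. g ^ k mod q) {..<9} {u. u < q \<and> coprime u q \<and> [u ^ 9 = 1] (mod q)}"
  shows "K a b q 9 = (\<Sum>k<9. add_char (of_int (a * int g ^ k + b * int g ^ (8 * k)) / of_nat q))"
proof -
  let ?U = "{u. u < q \<and> coprime u q \<and> [u ^ 9 = 1] (mod q)}"
  let ?F = "\<lambda>u. add_char (of_int (a * u + b * modular_inverse (int q) u) / of_nat q)"
  have ints: "{u. u \<in> {0..<int q} \<and> coprime u (int q) \<and> [u ^ 9 = 1] (mod int q)} = int ` ?U"
  proof (intro equalityI subsetI)
    fix u assume u: "u \<in> {u. u \<in> {0..<int q} \<and> coprime u (int q) \<and> [u ^ 9 = 1] (mod int q)}"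
    then have "u = int (nat u)" by simp
    moreover from this have "nat u \<in> ?U"
      using u by (metis (no_types, lifting) atLeastLessThan_iff cong_int_iff coprime_int_iff
          mem_Collect_eq of_nat_1 of_nat_less_iff of_nat_power)
    ultimately show "u \<in> int ` ?U" by blast
  next
    fix u assume "u \<in> int ` ?U"
    then obtain v where v: "u = int v" "v < q" "coprime v q" "[v ^ 9 = 1] (mod q)" by blast
    have "[int (v ^ 9) = int 1] (mod int q)" using v(4) by (simp only: cong_int_iff)
    then show "u \<in> {u. u \<in> {0..<int q} \<and> coprime u (int q) \<and> [u ^ 9 = 1] (mod int q)}"
      using v by simp
  qed
  have "K a b q 9 = (\<Sum>u\<in>int ` ?U. ?F u)"
    unfolding K_def ints ..
  also have "\<dots> = (\<Sum>u\<in>?U. ?F (int u))"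
    by (subst sum.reindex) auto
  also have "\<dots> = (\<Sum>k<9. ?F (int (g ^ k mod q)))"
    by (rule sum.reindex_bij_betw[OF bij, symmetric])
  also have "\<dots> = (\<Sum>k<9. add_char (of_int (a * int g ^ k + b * int g ^ (8 * k)) / of_nat q))"
  proof (intro sum.cong refl add_char_cong cong_add cong_mult)
    fix k assume k: "k \<in> {..<9::nat}"
    let ?u = "int (g ^ k mod q)"
    show u: "[?u = int g ^ k] (mod int q)" by (simp add: cong_def zmod_int)
    have "g ^ k mod q \<in> ?U" using bij k by (auto simp: bij_betw_def)
    then have "coprime ?u (int q)" by simp
    then have inv: "[modular_inverse (int q) ?u * ?u = 1] (mod int q)"
      by (rule cong_modular_inverse2)
    have "int g ^ 9 - 1 = (int g ^ 3 - 1) * (int g ^ 6 + int g ^ 3 + 1)"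
      by (simp add: algebra_simps flip: power_add)
    then have "[int g ^ 9 = 1] (mod int q)"
      using g by (simp add: cong_iff_dvd_diff)
    then have "[(int g ^ 9) ^ k = 1 ^ k] (mod int q)" by (rule cong_pow)
    then have "[int g ^ k * int g ^ (8 * k) = 1] (mod int q)"
      by (simp flip: power_add power_mult)
    then have "[?u * int g ^ (8 * k) = 1] (mod int q)"
      using cong_trans cong_scalar_right[OF u] by blast
    then have left: "[modular_inverse (int q) ?u * (?u * int g ^ (8 * k)) = modular_inverse (int q) ?u * 1] (mod int q)"
      by (rule cong_scalar_left)
    have "[(modular_inverse (int q) ?u * ?u) * int g ^ (8 * k) = 1 * int g ^ (8 * k)] (mod int q)"
      using inv by (rule cong_scalar_right)
    then have "[modular_inverse (int q) ?u * (?u * int g ^ (8 * k)) = 1 * int g ^ (8 * k)] (mod int q)"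
      by (simp only: mult.assoc)
    from cong_trans[OF cong_sym[OF left] this]
    show "[modular_inverse (int q) ?u = int g ^ (8 * k)] (mod int q)" by simp
  qed (use \<open>q > 0\<close> in auto)
  finally show ?thesis .
qed

text \<open>The arguments add up to multiples of \<open>g^6 + g^3 + 1\<close> in the
  \<open>a\<close> part and of \<open>g^48 + g^24 + 1\<close> in the \<open>b\<close> part, and both
  vanish modulo \<open>q\<close>.\<close>

lemma add_char_coset_product:
  fixes a b g :: int
  assumes "q > 0" and g: "[g ^ 6 + g ^ 3 + 1 = 0] (mod int q)"
  defines "X \<equiv> \<lambda>k. add_char (of_int (a * g ^ k + b * g ^ (8 * k)) / of_nat q)"
  shows "X k * X (k + 3) * X (k + 6) = 1"
proof -
  have "g ^ 9 - 1 = (g ^ 3 - 1) * (g ^ 6 + g ^ 3 + 1)"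
    by (simp add: algebra_simps flip: power_add)
  then have g9: "[g ^ 9 = 1] (mod int q)"
    using g by (simp add: cong_iff_dvd_diff)
  have red: "[g ^ (9 * m + n) = g ^ n] (mod int q)" for m n
    using cong_mult[OF cong_pow[OF g9, of m] cong_refl[of "g ^ n"]] by (simp add: power_add power_mult)
  \<comment> \<open>Since \<open>48 = 9 * 5 + 3\<close> and \<open>24 = 9 * 2 + 6\<close>, reduction
    by \<open>g^9 = 1\<close> gives the original relation with two terms swapped.\<close>
  have "[g ^ 48 + g ^ 24 + 1 = g ^ 3 + g ^ 6 + 1] (mod int q)"
    using red[of 5 3] red[of 2 6] by (intro cong_add cong_refl) simp_all
  moreover have "[g ^ 3 + g ^ 6 + 1 = 0] (mod int q)" using g by (simp add: add.commute)
  ultimately have g8: "[g ^ 48 + g ^ 24 + 1 = 0] (mod int q)" by (rule cong_trans)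
  have "(a * g ^ k + b * g ^ (8 * k)) + (a * g ^ (k + 3) + b * g ^ (8 * (k + 3)))
      + (a * g ^ (k + 6) + b * g ^ (8 * (k + 6))) =
      a * g ^ k * (g ^ 6 + g ^ 3 + 1) + b * g ^ (8 * k) * (g ^ 48 + g ^ 24 + 1)"
    by (simp add: algebra_simps power_add)
  moreover have "[\<dots> = a * g ^ k * 0 + b * g ^ (8 * k) * 0] (mod int q)"
    by (intro cong_add cong_mult cong_refl g g8)
  ultimately have "[(a * g ^ k + b * g ^ (8 * k)) + (a * g ^ (k + 3) + b * g ^ (8 * (k + 3)))
      + (a * g ^ (k + 6) + b * g ^ (8 * (k + 6))) = 0] (mod int q)" by simp
  from add_char_cong[OF this \<open>q > 0\<close>] show ?thesis
    unfolding X_def by (simp add: add_divide_distrib add_char_add)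
qed

section \<open>Threefold sums and the cosets of the cube roots of unity\<close>

lemma unit_triple_sums_iff:
  "w \<in> unit_triple_sums \<longleftrightarrow>
    (\<exists>x y z. cmod x = 1 \<and> cmod y = 1 \<and> cmod z = 1 \<and> x * y * z = 1 \<and> w = x + y + z)"
proof
  assume "w \<in> unit_triple_sums"
  then obtain \<alpha> \<beta> where "w = cis \<alpha> + cis \<beta> + cis (- \<alpha> - \<beta>)"
    by (auto simp: unit_triple_sums_def)
  then show "\<exists>x y z. cmod x = 1 \<and> cmod y = 1 \<and> cmod z = 1 \<and> x * y * z = 1 \<and> w = x + y + z"
    by (intro exI[of _ "cis \<alpha>"] exI[of _ "cis \<beta>"] exI[of _ "cis (- \<alpha> - \<beta>)"]) (simp add: cis_mult)
next
  assume "\<exists>x y z. cmod x = 1 \<and> cmod y = 1 \<and> cmod z = 1 \<and> x * y * z = 1 \<and> w = x + y + z"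
  then obtain x y z where *: "cmod x = 1" "cmod y = 1" "x * y * z = 1" and w: "w = x + y + z"
    by blast
  have nz: "x \<noteq> 0" "y \<noteq> 0" using * by auto
  then have xy: "x = cis (Arg x)" "y = cis (Arg y)"
    using * by (simp_all add: cis_Arg sgn_div_norm)
  have "x * y * cis (- Arg x - Arg y) = cis (Arg x) * cis (Arg y) * cis (- Arg x - Arg y)"
    using xy by metis
  also have "\<dots> = 1" by (simp add: cis_mult)
  finally have "x * y * cis (- Arg x - Arg y) = x * y * z" using * by simp
  then have "z = cis (- Arg x - Arg y)" using nz by simp
  then have "w = cis (Arg x) + cis (Arg y) + cis (- Arg x - Arg y)"
    using xy w by metis
  then show "w \<in> unit_triple_sums"
    unfolding unit_triple_sums_def by blast
qed

text \<open>The third entry is the conjugate of the product of the other two, so its error is at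
  most the sum of theirs, whence the factor 2.\<close>

lemma unit_triple_sum_diff_le:
  assumes "cmod x = 1" "cmod y = 1" "cmod z = 1" "x * y * z = 1"
    and "cmod x' = 1" "cmod y' = 1" "cmod z' = 1" "x' * y' * z' = 1"
  shows "cmod ((x + y + z) - (x' + y' + z')) \<le> 2 * (cmod (x - x') + cmod (y - y'))"
proof -
  have inverse_cnj: "c = cnj (a * b)" if "cmod a = 1" "cmod b = 1" "a * b * c = 1" for a b c
  proof -
    have "(a * b) * cnj (a * b) = 1"
      using that complex_norm_square[of "a * b"] by (simp add: norm_mult)
    then show ?thesis
      using that by (metis mult_cancel_left mult_zero_left zero_neq_one)
  qed
  have "cmod (z - z') = cmod (x * y - x' * y')"
    using inverse_cnj[OF assms(1,2,4)] inverse_cnj[OF assms(5,6,8)]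
    by (metis complex_cnj_diff complex_mod_cnj)
  also have "x * y - x' * y' = x * (y - y') + (x - x') * y'"
    by (simp add: algebra_simps)
  also have "cmod \<dots> \<le> cmod (y - y') + cmod (x - x')"
    using norm_triangle_ineq[of "x * (y - y')" "(x - x') * y'"] assms by (simp add: norm_mult)
  finally have z: "cmod (z - z') \<le> cmod (x - x') + cmod (y - y')" by simp
  have "(x + y + z) - (x' + y' + z') = ((x - x') + (y - y')) + (z - z')" by simp
  also have "cmod \<dots> \<le> cmod ((x - x') + (y - y')) + cmod (z - z')"
    by (rule norm_triangle_ineq)
  also have "\<dots> \<le> (cmod (x - x') + cmod (y - y')) + (cmod (x - x') + cmod (y - y'))"
    by (rule add_mono[OF norm_triangle_ineq z])
  finally show ?thesis by (simp only: mult_2)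
qed

lemma sum_lessThan_9_cosets:
  fixes X :: "nat \<Rightarrow> complex"
  shows "(\<Sum>k<9. X k) = (\<Sum>j<3. X j + X (j + 3) + X (j + 6))"
  by (simp add: eval_nat_numeral)

lemma H3_threefold_sum_iff:
  "w \<in> H3_threefold_sum \<longleftrightarrow>
    (\<exists>x y z. (\<forall>j<3. cmod (x j) = 1 \<and> cmod (y j) = 1 \<and> cmod (z j) = 1 \<and> x j * y j * z j = 1) \<and>
      w = (\<Sum>j<3::nat. x j + y j + z j))" (is "_ \<longleftrightarrow> ?R")
proof
  assume "w \<in> H3_threefold_sum"
  then obtain v where v: "\<forall>j<3::nat. v j \<in> unit_triple_sums" and w: "w = (\<Sum>j<3. v j)"
  proof -
    assume thesis: "\<And>v. \<forall>j<3::nat. v j \<in> unit_triple_sums \<Longrightarrow> w = (\<Sum>j<3. v j) \<Longrightarrow> thesis"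
    obtain w1 w2 w3 where *: "w = w1 + w2 + w3" "w1 \<in> unit_triple_sums" "w2 \<in> unit_triple_sums" "w3 \<in> unit_triple_sums"
      using \<open>w \<in> H3_threefold_sum\<close> unfolding H3_threefold_sum_def H3_eq by blast
    show thesis
      by (rule thesis[of "\<lambda>j. [w1, w2, w3] ! j"]) (use * in \<open>auto simp: eval_nat_numeral less_Suc_eq\<close>)
  qed
  then have "\<forall>j. \<exists>x y z. j < 3 \<longrightarrow> cmod x = 1 \<and> cmod y = 1 \<and> cmod z = 1 \<and> x * y * z = 1 \<and> v j = x + y + z"
    unfolding unit_triple_sums_iff by blast
  then obtain x y z where xyz: "\<forall>j<3. cmod (x j) = 1 \<and> cmod (y j) = 1 \<and> cmod (z j) = 1 \<and>
      x j * y j * z j = 1 \<and> v j = x j + y j + z j"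
    by metis
  then have "w = (\<Sum>j<3. x j + y j + z j)" by (simp add: w)
  then show ?R using xyz by blast
next
  assume ?R
  then obtain x y z where xyz: "\<forall>j<3. cmod (x j) = 1 \<and> cmod (y j) = 1 \<and> cmod (z j) = 1 \<and> x j * y j * z j = 1"
    and w: "w = (\<Sum>j<3::nat. x j + y j + z j)" by blast
  have "x j + y j + z j \<in> H3" if "j < 3" for j
    using xyz that unfolding H3_eq unit_triple_sums_iff by blast
  moreover have "w = (x 0 + y 0 + z 0) + (x 1 + y 1 + z 1) + (x 2 + y 2 + z 2)"
    by (simp add: w eval_nat_numeral)
  ultimately show "w \<in> H3_threefold_sum"
    unfolding H3_threefold_sum_def mem_Collect_eq
    by (intro exI[of _ "x 0 + y 0 + z 0"] exI[of _ "x 1 + y 1 + z 1"] exI[of _ "x 2 + y 2 + z 2"]) simp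
qed

lemma K9_in_H3_threefold_sum:
  assumes "prime p" "[p = 1] (mod 9)" "\<alpha> \<ge> 1"
  shows "K a b (p ^ \<alpha>) 9 \<in> H3_threefold_sum"
proof -
  obtain g where g: "[int g ^ 6 + int g ^ 3 + 1 = 0] (mod int (p ^ \<alpha>))"
    "bij_betw (\<lambda>k. g ^ k mod p ^ \<alpha>) {..<9} {u. u < p ^ \<alpha> \<and> coprime u (p ^ \<alpha>) \<and> [u ^ 9 = 1] (mod p ^ \<alpha>)}"
    using exists_ninth_root_generator[OF assms] .
  have q: "p ^ \<alpha> > 0" using assms(1) prime_gt_0_nat by simp
  define X where "X k = add_char (of_int (a * int g ^ k + b * int g ^ (8 * k)) / of_nat (p ^ \<alpha>))" for k
  have X: "X k * X (k + 3) * X (k + 6) = 1" for k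
    unfolding X_def by (rule add_char_coset_product[OF q g(1)])
  have "K a b (p ^ \<alpha>) 9 = (\<Sum>j<3. X j + X (j + 3) + X (j + 6))"
    unfolding K9_eq_sum[OF q g] X_def[symmetric] by (rule sum_lessThan_9_cosets)
  moreover have "cmod (X k) = 1" for k by (simp add: X_def)
  ultimately show ?thesis
    unfolding H3_threefold_sum_iff using X
    by (intro exI[of _ X] exI[of _ "\<lambda>j. X (j + 3)"] exI[of _ "\<lambda>j. X (j + 6)"]) simp
qed

lemma K9_dense_in_H3_threefold_sum:
  fixes \<epsilon> :: real
  assumes "\<epsilon> > 0" "w \<in> H3_threefold_sum"
  shows "\<exists>Q. \<forall>p \<alpha>. prime p \<and> [p = 1] (mod 9) \<and> \<alpha> \<ge> 1 \<and> p ^ \<alpha> \<ge> Q \<longrightarrow>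
    (\<exists>a\<in>{0..int (p ^ \<alpha>) - 1}. cmod (K a b (p ^ \<alpha>) 9 - w) < \<epsilon>)"
proof -
  obtain x y z where xyz: "\<forall>j<3. cmod (x j) = 1 \<and> cmod (y j) = 1 \<and> cmod (z j) = 1 \<and> x j * y j * z j = 1"
    and w: "w = (\<Sum>j<3::nat. x j + y j + z j)"
    using assms(2) unfolding H3_threefold_sum_iff by blast
  \<comment> \<open>Two errors below \<epsilon>/12 in a coset, doubled to account for the third
    entry, give \<epsilon>/3; three cosets give \<epsilon>.\<close>
  have "\<epsilon> / 12 > 0" using assms by simp
  \<comment> \<open>Uniformity in \<open>c\<close> matters: the targets used below depend on
    \<open>q\<close> and \<open>g\<close> through \<open>B\<close>.\<close>
  then obtain Q where Q: "\<And>q g c. \<lbrakk>q \<ge> Q; [g ^ 6 + g ^ 3 + 1 = 0] (mod int q); \<forall>k<6. cmod (c k) = 1\<rbrakk> \<Longrightarrow>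
      \<exists>a<q. \<forall>k<6. cmod (add_char (of_int (int a * g ^ k) / of_nat q) - c k) < \<epsilon> / 12"
    using dense_power_multiples unfolding eventually_sequentially by blast
  have "\<exists>a\<in>{0..int (p ^ \<alpha>) - 1}. cmod (K a b (p ^ \<alpha>) 9 - w) < \<epsilon>"
    if p: "prime p" "[p = 1] (mod 9)" "\<alpha> \<ge> 1" and large: "p ^ \<alpha> \<ge> Q" for p \<alpha>
  proof -
    obtain g where g: "[int g ^ 6 + int g ^ 3 + 1 = 0] (mod int (p ^ \<alpha>))"
      "bij_betw (\<lambda>k. g ^ k mod p ^ \<alpha>) {..<9} {u. u < p ^ \<alpha> \<and> coprime u (p ^ \<alpha>) \<and> [u ^ 9 = 1] (mod p ^ \<alpha>)}"
      using exists_ninth_root_generator[OF p] .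
    define q where "q = p ^ \<alpha>"
    note g = g[folded q_def]
    have q: "q > 0" using p(1) prime_gt_0_nat by (simp add: q_def)
    \<comment> \<open>Only six coordinates are prescribed, the \<open>x\<close> and \<open>y\<close>
      entries; the \<open>z\<close> entries follow from the product condition.\<close>
    define t where "t k = (if k < 3 then x k else y (k - 3))" for k
    define B where "B k = add_char (of_int (b * int g ^ (8 * k)) / of_nat q)" for k
    have t: "cmod (t k) = 1" if "k < 6" for k using xyz that by (auto simp: t_def)
    have B: "cmod (B k) = 1" for k by (simp add: B_def)
    \<comment> \<open>The \<open>b\<close> part multiplies each term by the unit \<open>B k\<close>,
      so the target is rotated back by its conjugate.\<close>
    have "\<forall>k<6. cmod (t k * cnj (B k)) = 1" using t B by (simp add: norm_mult)
    from Q[OF large[folded q_def] g(1) this] obtain a where a: "a < q"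
      "\<forall>k<6. cmod (add_char (of_int (int a * int g ^ k) / of_nat q) - t k * cnj (B k)) < \<epsilon> / 12"
      by blast
    define X where "X k = add_char (of_int (int a * int g ^ k + b * int g ^ (8 * k)) / of_nat q)" for k
    have X: "X k * X (k + 3) * X (k + 6) = 1" for k
      unfolding X_def by (rule add_char_coset_product[OF q g(1)])
    have X_norm: "cmod (X k) = 1" for k by (simp add: X_def)
    have close: "cmod (X k - t k) < \<epsilon> / 12" if "k < 6" for k
    proof -
      have "B k * cnj (B k) = 1" using B by (simp add: complex_norm_square[symmetric])
      then have "X k - t k = (add_char (of_int (int a * int g ^ k) / of_nat q) - t k * cnj (B k)) * B k"
        by (simp add: X_def B_def add_divide_distrib add_char_add algebra_simps)
      then show ?thesis using a(2) B that by (simp add: norm_mult)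
    qed
    have coset: "cmod ((X j + X (j + 3) + X (j + 6)) - (x j + y j + z j)) < \<epsilon> / 3" if "j < 3" for j
    proof -
      have "cmod (X j - x j) < \<epsilon> / 12" "cmod (X (j + 3) - y j) < \<epsilon> / 12"
        using close[of j] close[of "j + 3"] that by (simp_all add: t_def)
      moreover have "cmod ((X j + X (j + 3) + X (j + 6)) - (x j + y j + z j)) \<le>
          2 * (cmod (X j - x j) + cmod (X (j + 3) - y j))"
        using xyz that X X_norm by (intro unit_triple_sum_diff_le) auto
      ultimately show ?thesis by simp
    qed
    have "K (int a) b q 9 - w = (\<Sum>j<3. (X j + X (j + 3) + X (j + 6)) - (x j + y j + z j))"
      unfolding K9_eq_sum[OF q g] X_def[symmetric] w sum_lessThan_9_cosets sum_subtractf ..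
    also have "cmod \<dots> < (\<Sum>j<3::nat. \<epsilon> / 3)"
      by (rule le_less_trans[OF norm_sum sum_strict_mono]) (use coset in \<open>auto simp: lessThan_empty_iff\<close>)
    finally have "cmod (K (int a) b q 9 - w) < \<epsilon>" by simp
    moreover have "int a \<in> {0..int q - 1}" using a(1) by simp
    ultimately show ?thesis unfolding q_def by blast
  qed
  then show ?thesis by blast
qed

theorem theorem3:
  shows "(\<forall>(p::nat) (\<alpha>::nat) (a::int) (b::int).
            prime p \<and> [p = 1] (mod 9) \<and> \<alpha> \<ge> 1 \<and>
            a \<in> {0..int (p ^ \<alpha>) - 1} \<and> b \<in> {0..int (p ^ \<alpha>) - 1}
            \<longrightarrow> K a b (p ^ \<alpha>) 9 \<in> H3_threefold_sum)
       \<and> (\<forall>(\<epsilon>::real) (b::int) (w::complex).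
            \<epsilon> > 0 \<and> w \<in> H3_threefold_sum
            \<longrightarrow> (\<exists>Q::nat. \<forall>(p::nat) (\<alpha>::nat).
                   prime p \<and> [p = 1] (mod 9) \<and> \<alpha> \<ge> 1 \<and> p ^ \<alpha> \<ge> Q
                   \<longrightarrow> (\<exists>a\<in>{0..int (p ^ \<alpha>) - 1}. cmod (K a b (p ^ \<alpha>) 9 - w) < \<epsilon>)))"
  using K9_in_H3_threefold_sum K9_dense_in_H3_threefold_sum by blast

end
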